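(* Let $\mathcal{A}$ be a faithful Banach algebra and let $\varphi\in\Delta(\mathcal{A})$. Suppose that $\overline{\langle \mathcal{A}\cdot I_{\varphi}\rangle}= I_{\varphi}$. Then the following cardinalities are equal: $$\vert \mathrm{TLIM}_{\varphi}(\mathrm{LUC}(\mathcal{A}_M^* )^* )\vert = \vert \mathrm{TLIM}_{\varphi}(\mathrm{LUC}(\mathcal{A}^* )^* )\vert= \vert \mathrm{TLIM}_{\varphi}(\mathcal{A}^{**})\vert= \vert \mathrm{TLIM}_{\varphi}(\mathcal{A}_M^{**})\vert.$$
   Context: A Banach algebra $\mathcal{A}$ is faithful if for each $a\in\mathcal{A}\setminus\{0\}$ there are $b,c\in\mathcal{A}$ with $ab\neq 0$ and $ca\neq 0$. The multiplier norm on a faithful $\mathcal{A}$ is $\|a\|_M=\sup\{\|ab\|,\|ba\| : b\in\mathcal{A},\ \|b\|\le 1\}$, and $\mathcal{A}_M$ denotes the completion of $\mathcal{A}$ with respect to $\|\cdot\|_M$; it is a Banach algebra containing $\mathcal{A}$ as a dense two-sided ideal. $\Delta(\mathcal{A})$ is the set of characters (non-zero multiplicative linear functionals) of $\mathcal{A}$; every $\varphi\in\Delta(\mathcal{A})$ extends uniquely by continuity to a character of $\mathcal{A}_M$, again denoted $\varphi$. $I_\varphi=\{a\in\mathcal{A}:\varphi(a)=0\}$, and $\overline{\langle\mathcal{A}\cdot I_\varphi\rangle}$ is the closed linear span in $\mathcal{A}$ of $\{ab:a\in\mathcal{A},b\in I_\varphi\}$. For a Banach algebra $\mathcal{B}$,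 $f\in\mathcal{B}^*$, $a,b\in\mathcal{B}$ put $\langle f\cdot a,b\rangle=\langle f,ab\rangle$; $\mathrm{LUC}(\mathcal{B}^* )$ is the norm closure in $\mathcal{B}^*$ of the linear span of $\{f\cdot a:f\in\mathcal{B}^*,a\in\mathcal{B}\}$. For $\varphi\in\Delta(\mathcal{B})$ and a closed subspace $X\subseteq\mathcal{B}^*$ containing $\varphi$ with $X\cdot\mathcal{B}\subseteq X$, a topologically left invariant $\varphi$-mean on $X$ is an $m\in X^*$ with $m(\varphi)=1$ and $\langle m,f\cdot a\rangle=\varphi(a)\langle m,f\rangle$ for all $f\in X$, $a\in\mathcal{B}$. $\mathrm{TLIM}_\varphi(X^* )$ is the set of those with $\|m\|=1$. This is used with $\mathcal{B}=\mathcal{A}$ and $\mathcal{B}=\mathcal{A}_M$, for $X=\mathcal{B}^*$ and $X=\mathrm{LUC}(\mathcal{B}^* )$.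
   Formalization: The formal statement additionally assumes ‖φ‖ = 1 in the dual of A; without it the claim fails, e.g. for A = ℂ with norm 2|z| and φ = id, where the two sets for A are empty and the two for A_M have one element. *)

theory Defs
  imports "HOL-Analysis.Analysis" "HOL-Library.Equipollence"
begin

section \<open>Complex normed spaces and Banach algebras\<close>

text \<open>
  The library only has real normed spaces. A complex one is a real one with a complex scalar
  multiplication that extends the real one, so that limits, closures and norms are those of the
  real classes. The algebras are not assumed to be unital or commutative.
\<close>

class scaleC = scaleR +
  fixes scaleC :: "complex \<Rightarrow> 'a \<Rightarrow> 'a" (infixr \<open>*\<^sub>C\<close> 75)
  assumes scaleR_scaleC: "r *\<^sub>R x = complex_of_real r *\<^sub>C x"

class complex_vector = real_vector + scaleC +
  assumes scaleC_add_right: "c *\<^sub>C (x + y) = c *\<^sub>C x + c *\<^sub>C y"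
    and scaleC_add_left: "(c + d) *\<^sub>C x = c *\<^sub>C x + d *\<^sub>C x"
    and scaleC_scaleC: "c *\<^sub>C (d *\<^sub>C x) = (c * d) *\<^sub>C x"
    and scaleC_one: "1 *\<^sub>C x = x"

global_interpretation complex_vector: vector_space "scaleC :: complex \<Rightarrow> 'a \<Rightarrow> 'a::complex_vector"
  defines cspan = complex_vector.span
  by unfold_locales (simp_all add: scaleC_add_right scaleC_add_left scaleC_scaleC scaleC_one)

class complex_normed_vector = real_normed_vector + complex_vector +
  assumes norm_scaleC: "norm (c *\<^sub>C x) = cmod c * norm x"

class complex_banach_algebra = real_normed_algebra + complex_normed_vector + banach +
  assumes mult_scaleC_left: "(c *\<^sub>C x) * y = c *\<^sub>C (x * y)"
    and mult_scaleC_right: "x * (c *\<^sub>C y) = c *\<^sub>C (x * y)"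

instantiation complex :: complex_banach_algebra
begin

definition scaleC_complex :: "complex \<Rightarrow> complex \<Rightarrow> complex"
  where "scaleC_complex = (*)"

instance
  by standard (simp_all add: scaleC_complex_def scaleR_conv_of_real algebra_simps norm_mult)

end

lemma bounded_linear_scaleC: "bounded_linear (\<lambda>x::'a::complex_normed_vector. c *\<^sub>C x)"
proof (rule bounded_linear_intro)
  fix x y :: "'a" and r
  show "c *\<^sub>C (x + y) = c *\<^sub>C x + c *\<^sub>C y"
    by (rule scaleC_add_right)
  show "c *\<^sub>C (r *\<^sub>R x) = r *\<^sub>R (c *\<^sub>C x)"
    by (simp add: scaleR_scaleC scaleC_scaleC mult.commute)
  show "norm (c *\<^sub>C x) \<le> norm x * cmod c"
    by (simp add: norm_scaleC)
qed

instantiation blinfun :: (real_normed_vector, complex_normed_vector) complex_normed_vector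
begin

lift_definition scaleC_blinfun :: "complex \<Rightarrow> ('a \<Rightarrow>\<^sub>L 'b) \<Rightarrow> ('a \<Rightarrow>\<^sub>L 'b)"
  is "\<lambda>c f x. c *\<^sub>C f x"
  by (rule bounded_linear_compose[OF bounded_linear_scaleC])

lemma norm_scaleC_blinfun_le: "norm (c *\<^sub>C f) \<le> cmod c * norm f" for f :: "'a \<Rightarrow>\<^sub>L 'b"
proof (rule norm_blinfun_bound)
  fix x
  have "norm (blinfun_apply (c *\<^sub>C f) x) = cmod c * norm (blinfun_apply f x)"
    by (simp add: scaleC_blinfun.rep_eq norm_scaleC)
  also have "\<dots> \<le> cmod c * (norm f * norm x)"
    by (intro mult_left_mono norm_blinfun) simp
  finally show "norm (blinfun_apply (c *\<^sub>C f) x) \<le> cmod c * norm f * norm x"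
    by (simp add: mult.assoc)
qed simp

instance
proof
  fix f g :: "'a \<Rightarrow>\<^sub>L 'b" and c d :: complex and r :: real
  show "r *\<^sub>R f = complex_of_real r *\<^sub>C f"
    by transfer (simp add: scaleR_scaleC)
  show "c *\<^sub>C (f + g) = c *\<^sub>C f + c *\<^sub>C g"
    by transfer (simp add: scaleC_add_right)
  show "(c + d) *\<^sub>C f = c *\<^sub>C f + d *\<^sub>C f"
    by transfer (simp add: scaleC_add_left)
  show ss: "c *\<^sub>C (d *\<^sub>C f) = (c * d) *\<^sub>C f" for c d and f :: "'a \<Rightarrow>\<^sub>L 'b"
    by transfer (simp add: scaleC_scaleC)
  show s1: "1 *\<^sub>C f = f" for f :: "'a \<Rightarrow>\<^sub>L 'b"
    by transfer (simp add: scaleC_one)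
  show "norm (c *\<^sub>C f) = cmod c * norm f"
  proof (cases "c = 0")
    case True
    then show ?thesis
      using norm_scaleC_blinfun_le[of c f] by simp
  next
    case False
    have "norm f = norm (inverse c *\<^sub>C (c *\<^sub>C f))"
      using False by (simp add: ss s1)
    also have "\<dots> \<le> inverse (cmod c) * norm (c *\<^sub>C f)"
      using norm_scaleC_blinfun_le[of "inverse c" "c *\<^sub>C f"] by (simp add: norm_inverse)
    finally have "cmod c * norm f \<le> norm (c *\<^sub>C f)"
      using False by (simp add: field_simps)
    with norm_scaleC_blinfun_le[of c f] show ?thesis
      by simp
  qed
qed

end

definition faithful :: "'a::complex_banach_algebra itself \<Rightarrow> bool"
  where "faithful _ \<longleftrightarrow> (\<forall>a::'a. a \<noteq> 0 \<longrightarrow> (\<exists>b. a * b \<noteq> 0) \<and> (\<exists>c. c * a \<noteq> 0))"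


section \<open>Characters\<close>

definition characters :: "('a::complex_banach_algebra \<Rightarrow> complex) set" (\<open>\<Delta>\<close>)
  where "\<Delta> = {\<phi>. Vector_Spaces.linear (*\<^sub>C) (*\<^sub>C) \<phi> \<and> (\<forall>a b. \<phi> (a * b) = \<phi> a * \<phi> b)
                 \<and> (\<exists>a. \<phi> a \<noteq> 0)}"

definition char_ideal :: "('a::complex_banach_algebra \<Rightarrow> complex) \<Rightarrow> 'a set"
  where "char_ideal \<phi> = {a. \<phi> a = 0}"

lemma character_add: "\<phi> \<in> \<Delta> \<Longrightarrow> \<phi> (a + b) = \<phi> a + \<phi> b"
  and character_scaleC: "\<phi> \<in> \<Delta> \<Longrightarrow> \<phi> (c *\<^sub>C a) = c * \<phi> a"
  and character_mult: "\<phi> \<in> \<Delta> \<Longrightarrow> \<phi> (a * b) = \<phi> a * \<phi> b"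
  by (auto simp: characters_def linear_iff_module_hom module_hom_iff scaleC_complex_def)

lemma character_diff: "\<phi> \<in> \<Delta> \<Longrightarrow> \<phi> (a - b) = \<phi> a - \<phi> b"
  using character_add[of \<phi> "a - b" b] by simp

lemma character_norm_le:
  assumes "\<phi> \<in> \<Delta>"
  shows "cmod (\<phi> a) \<le> norm a"
proof (rule ccontr)
  assume *: "\<not> cmod (\<phi> a) \<le> norm a"
  then have nz: "\<phi> a \<noteq> 0"
    by auto
  define x where "x = inverse (\<phi> a) *\<^sub>C a"
  have x1: "\<phi> x = 1"
    using nz by (simp add: x_def character_scaleC[OF assms])
  have nx: "norm x < 1"
    using * nz by (simp add: x_def norm_scaleC norm_inverse norm_divide divide_simps)
  define p where "p n = ((\<lambda>y. x * y) ^^ n) x" for n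
  have p_Suc: "p (Suc n) = x * p n" for n
    by (simp add: p_def)
  have np: "norm (p n) \<le> norm x ^ n * norm x" for n
  proof (induction n)
    case (Suc n)
    have "norm (p (Suc n)) \<le> norm x * norm (p n)"
      unfolding p_Suc by (rule norm_mult_ineq)
    also have "\<dots> \<le> norm x * (norm x ^ n * norm x)"
      by (intro mult_left_mono Suc) simp
    finally show ?case
      by simp
  qed (simp add: p_def)
  have sm: "summable p"
    by (rule summable_comparison_test'[of "\<lambda>n. norm x ^ n * norm x" 0])
      (use nx np in \<open>auto intro!: summable_mult2 summable_geometric\<close>)
  define b where "b = suminf p"
  have "b = p 0 + (\<Sum>n. p (Suc n))"
    unfolding b_def using suminf_split_head[OF sm] by simp
  also have "(\<Sum>n. p (Suc n)) = x * b"
    unfolding p_Suc b_def by (rule suminf_mult[OF sm])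
  finally have "b = x + x * b"
    by (simp add: p_def)
  then have "\<phi> b = \<phi> x + \<phi> x * \<phi> b"
    by (metis assms character_add character_mult)
  with x1 show False
    by simp
qed

lemma character_bounded_linear:
  assumes "\<phi> \<in> \<Delta>"
  shows "bounded_linear \<phi>"
proof (rule bounded_linear_intro)
  show "\<phi> (x + y) = \<phi> x + \<phi> y" for x y
    using assms by (rule character_add)
  show "\<phi> (r *\<^sub>R x) = r *\<^sub>R \<phi> x" for r x
    by (simp add: scaleR_scaleC character_scaleC[OF assms] scaleC_complex_def)
  show "norm (\<phi> x) \<le> norm x * 1" for x
    using character_norm_le[OF assms] by simp
qed


section \<open>The multiplier norm and its completion\<close>

definition mult_norm :: "'a::complex_banach_algebra \<Rightarrow> real"
  where "mult_norm a = Sup ({norm (a * b) | b. norm b \<le> 1} \<union> {norm (b * a) | b. norm b \<le> 1})"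

text \<open>
  The completion is determined up to an isometric isomorphism that respects the embedding; the
  following says that the Banach algebra \<open>'b\<close>, with embedding \<open>\<iota>\<close>, is such a completion.
\<close>

definition is_mult_completion :: "('a::complex_banach_algebra \<Rightarrow> 'b::complex_banach_algebra) \<Rightarrow> bool"
  where "is_mult_completion \<iota> \<longleftrightarrow>
    Vector_Spaces.linear (*\<^sub>C) (*\<^sub>C) \<iota> \<and> (\<forall>a b. \<iota> (a * b) = \<iota> a * \<iota> b)
    \<and> (\<forall>a. norm (\<iota> a) = mult_norm a) \<and> closure (range \<iota>) = UNIV"

definition char_extension ::
    "('a::complex_banach_algebra \<Rightarrow> 'b::complex_banach_algebra) \<Rightarrow> ('a \<Rightarrow> complex) \<Rightarrow> 'b \<Rightarrow> complex"
  where "char_extension \<iota> \<phi> = (THE \<psi>. \<psi> \<in> \<Delta> \<and> (\<forall>a. \<psi> (\<iota> a) = \<phi> a))"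

lemma norm_mult_le_mult_norm:
  assumes "norm b \<le> 1"
  shows "norm (a * b) \<le> mult_norm a"
  unfolding mult_norm_def
proof (rule cSup_upper)
  have "norm (a * b) \<le> norm a" "norm (b * a) \<le> norm a" if "norm b \<le> 1" for b
    using norm_mult_ineq[of a b] norm_mult_ineq[of b a] that
      mult_left_mono[OF that norm_ge_zero[of a]] by (simp_all add: mult.commute)
  then show "bdd_above ({norm (a * b) | b. norm b \<le> 1} \<union> {norm (b * a) | b. norm b \<le> 1})"
    by (intro bdd_aboveI[of _ "norm a"]) auto
qed (use assms in auto)

lemma character_extends:
  fixes \<iota> :: "'a::complex_banach_algebra \<Rightarrow> 'b::complex_banach_algebra"
  assumes \<iota>: "is_mult_completion \<iota>" and \<phi>: "\<phi> \<in> \<Delta>"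
  shows "\<exists>!\<psi>. \<psi> \<in> \<Delta> \<and> (\<forall>a. \<psi> (\<iota> a) = \<phi> a)"
proof -
  have add: "\<iota> (a + b) = \<iota> a + \<iota> b" and scl: "\<iota> (c *\<^sub>C a) = c *\<^sub>C \<iota> a"
    and mul: "\<iota> (a * b) = \<iota> a * \<iota> b" and nrm: "norm (\<iota> a) = mult_norm a" for a b c
    using \<iota> by (auto simp: is_mult_completion_def linear_iff_module_hom module_hom_iff)
  have dense: "closure (range \<iota>) = UNIV"
    using \<iota> by (simp add: is_mult_completion_def)
  have diff: "\<iota> (a - b) = \<iota> a - \<iota> b" for a b
    using add[of "a - b" b] by simp
  obtain u where "\<phi> u \<noteq> 0"
    using \<phi> by (auto simp: characters_def)
  define e where "e = complex_of_real (inverse (norm u)) *\<^sub>C u"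
  have "u \<noteq> 0"
    using \<open>\<phi> u \<noteq> 0\<close> character_diff[OF \<phi>, of u u] by auto
  then have e: "\<phi> e \<noteq> 0" "norm e \<le> 1"
    using \<open>\<phi> u \<noteq> 0\<close> by (auto simp: e_def character_scaleC[OF \<phi>] norm_scaleC norm_inverse)
  define K where "K = inverse (cmod (\<phi> e))"
  have K: "K > 0"
    using e by (simp add: K_def)
  have bound: "cmod (\<phi> a) \<le> K * norm (\<iota> a)" for a
  proof -
    have "cmod (\<phi> a) * cmod (\<phi> e) \<le> norm (a * e)"
      using character_norm_le[OF \<phi>, of "a * e"] by (simp add: character_mult[OF \<phi>] norm_mult)
    also have "\<dots> \<le> norm (\<iota> a)"
      using norm_mult_le_mult_norm[OF e(2)] nrm by simp
    finally show ?thesis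
      using e by (simp add: K_def field_simps)
  qed
  define g where "g y = \<phi> (inv \<iota> y)" for y
  have g: "g (\<iota> a) = \<phi> a" for a
  proof -
    have "\<iota> (inv \<iota> (\<iota> a)) = \<iota> a"
      by (simp add: f_inv_into_f)
    then have "\<iota> (inv \<iota> (\<iota> a) - a) = 0"
      by (simp add: diff)
    then show ?thesis
      using bound[of "inv \<iota> (\<iota> a) - a"] by (simp add: g_def character_diff[OF \<phi>])
  qed
  have "uniformly_continuous_on (range \<iota>) g"
    unfolding uniformly_continuous_on_def
  proof (intro allI impI)
    fix d :: real assume "0 < d"
    have "dist (g y) (g x) \<le> K * dist y x" if "x \<in> range \<iota>" "y \<in> range \<iota>" for x y
      using that bound by (auto simp: g dist_norm simp flip: diff character_diff[OF \<phi>])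
    moreover have "K * t < d" if "t < d / K" for t
      using that K by (simp add: field_simps)
    ultimately have "\<forall>x\<in>range \<iota>. \<forall>x'\<in>range \<iota>. dist x' x < d / K \<longrightarrow> dist (g x') (g x) < d"
      by (meson le_less_trans)
    then show "\<exists>\<delta>>0. \<forall>x\<in>range \<iota>. \<forall>x'\<in>range \<iota>. dist x' x < \<delta> \<longrightarrow> dist (g x') (g x) < d"
      using \<open>0 < d\<close> K by (intro exI[of _ "d / K"]) simp
  qed
  then obtain \<psi> where uc: "uniformly_continuous_on (closure (range \<iota>)) \<psi>"
      and \<psi>': "\<And>x. x \<in> range \<iota> \<Longrightarrow> g x = \<psi> x"
    by (rule uniformly_continuous_on_extension_on_closure) blast
  have \<psi>: "\<psi> (\<iota> a) = \<phi> a" for a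
    using \<psi>'[of "\<iota> a"] g by simp
  have cont: "continuous_on UNIV \<psi>"
    using uniformly_continuous_imp_continuous[OF uc] by (simp add: dense)
  have eq: "h x = k x" if "continuous_on UNIV h" "continuous_on UNIV k" "\<And>a. h (\<iota> a) = k (\<iota> a)"
    for h k :: "'b \<Rightarrow> complex" and x
  proof -
    have "closure (range \<iota>) \<subseteq> {x. h x = k x}"
      using that by (intro closure_minimal closed_Collect_eq) auto
    then show ?thesis
      by (auto simp: dense)
  qed
  have comp: "continuous_on UNIV (\<lambda>x. \<psi> (h x))" if "continuous_on UNIV h" for h :: "'b \<Rightarrow> 'b"
    using continuous_on_compose2[OF cont that] by simp
  have sc: "continuous_on UNIV (\<lambda>x::'b. c *\<^sub>C x)" for c
    by (rule linear_continuous_on[OF bounded_linear_scaleC])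
  have \<psi>_add: "\<psi> (x + y) = \<psi> x + \<psi> y" for x y
  proof -
    have 1: "continuous_on UNIV (\<lambda>x. \<psi> (x + z))" "continuous_on UNIV (\<lambda>y. \<psi> (z + y))" for z
      by (rule comp, intro continuous_intros)+
    have 2: "continuous_on UNIV (\<lambda>x. \<psi> x + z)" "continuous_on UNIV (\<lambda>y. z + \<psi> y)" for z
      by (intro continuous_intros cont)+
    have "\<psi> (\<iota> a + \<iota> b) = \<psi> (\<iota> a) + \<psi> (\<iota> b)" for a b
      unfolding add[symmetric] \<psi> by (rule character_add[OF \<phi>])
    then have "\<psi> (x + \<iota> b) = \<psi> x + \<psi> (\<iota> b)" for x b
      by (rule eq[OF 1(1) 2(1)])
    then show ?thesis
      by (rule eq[OF 1(2) 2(2)])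
  qed
  have \<psi>_mult: "\<psi> (x * y) = \<psi> x * \<psi> y" for x y
  proof -
    have 1: "continuous_on UNIV (\<lambda>x. \<psi> (x * z))" "continuous_on UNIV (\<lambda>y. \<psi> (z * y))" for z
      by (rule comp, intro continuous_intros)+
    have 2: "continuous_on UNIV (\<lambda>x. \<psi> x * z)" "continuous_on UNIV (\<lambda>y. z * \<psi> y)" for z
      by (intro continuous_intros cont)+
    have "\<psi> (\<iota> a * \<iota> b) = \<psi> (\<iota> a) * \<psi> (\<iota> b)" for a b
      unfolding mul[symmetric] \<psi> by (rule character_mult[OF \<phi>])
    then have "\<psi> (x * \<iota> b) = \<psi> x * \<psi> (\<iota> b)" for x b
      by (rule eq[OF 1(1) 2(1)])
    then show ?thesis
      by (rule eq[OF 1(2) 2(2)])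
  qed
  have \<psi>_scale: "\<psi> (c *\<^sub>C x) = c * \<psi> x" for c x
  proof (rule eq)
    show "continuous_on UNIV (\<lambda>x. \<psi> (c *\<^sub>C x))"
      by (rule comp[OF sc])
    show "continuous_on UNIV (\<lambda>x. c * \<psi> x)"
      by (intro continuous_intros cont)
    show "\<psi> (c *\<^sub>C \<iota> a) = c * \<psi> (\<iota> a)" for a
      unfolding scl[symmetric] \<psi> by (rule character_scaleC[OF \<phi>])
  qed
  have "Vector_Spaces.linear (*\<^sub>C) (*\<^sub>C) \<psi>"
    unfolding linear_iff_module_hom module_hom_iff
    by (intro conjI allI complex_vector.module_axioms)
      (simp_all add: \<psi>_add \<psi>_scale scaleC_complex_def)
  moreover have "\<psi> (\<iota> u) \<noteq> 0"
    by (simp add: \<psi> \<open>\<phi> u \<noteq> 0\<close>)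
  ultimately have \<psi>_char: "\<psi> \<in> \<Delta>"
    using \<psi>_mult unfolding characters_def by blast
  show ?thesis
  proof (rule ex1I[of _ \<psi>])
    show "\<psi> \<in> \<Delta> \<and> (\<forall>a. \<psi> (\<iota> a) = \<phi> a)"
      using \<psi>_char \<psi> by simp
    show "\<psi>' = \<psi>" if "\<psi>' \<in> \<Delta> \<and> (\<forall>a. \<psi>' (\<iota> a) = \<phi> a)" for \<psi>'
    proof
      have "continuous_on UNIV \<psi>'"
        using that by (intro linear_continuous_on character_bounded_linear) simp
      then show "\<psi>' x = \<psi> x" for x
        by (rule eq[OF _ cont]) (use that in \<open>simp add: \<psi>\<close>)
    qed
  qed
qed


section \<open>Dual spaces and invariant means\<close>

text \<open>
  The type \<open>'a \<Rightarrow>\<^sub>L complex\<close> consists of the bounded real-linear maps, with the operator norm; the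
  dual is the closed subspace of the complex-linear ones.
\<close>

definition dual :: "('a::complex_normed_vector \<Rightarrow>\<^sub>L complex) set"
  where "dual = {f. \<forall>c x. blinfun_apply f (c *\<^sub>C x) = c *\<^sub>C blinfun_apply f x}"

lift_definition dual_act :: "('a::complex_banach_algebra \<Rightarrow>\<^sub>L complex) \<Rightarrow> 'a \<Rightarrow> ('a \<Rightarrow>\<^sub>L complex)"
    (infixl \<open>\<bullet>\<^sub>d\<close> 70)
  is "\<lambda>f a b. f (a * b)"
  by (rule bounded_linear_compose[OF _ bounded_linear_mult_right])

definition LUC :: "('a::complex_banach_algebra \<Rightarrow>\<^sub>L complex) set"
  where "LUC = closure (cspan {f \<bullet>\<^sub>d a | f a. f \<in> dual})"

text \<open>
  The dual of a subspace \<open>X\<close>. A functional on \<open>X\<close> is represented by a function on the ambient type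
  with the fixed value \<open>undefined\<close> outside \<open>X\<close>, so that distinct functions in \<open>dual_on X\<close> are
  distinct functionals on \<open>X\<close>.
\<close>

definition dual_on :: "'v::complex_normed_vector set \<Rightarrow> ('v \<Rightarrow> complex) set"
  where "dual_on X = {m \<in> extensional X.
    (\<forall>f\<in>X. \<forall>g\<in>X. m (f + g) = m f + m g) \<and> (\<forall>c. \<forall>f\<in>X. m (c *\<^sub>C f) = c *\<^sub>C m f)
    \<and> (\<exists>K. \<forall>f\<in>X. cmod (m f) \<le> K * norm f)}"

definition dual_on_norm :: "'v::complex_normed_vector set \<Rightarrow> ('v \<Rightarrow> complex) \<Rightarrow> real"
  where "dual_on_norm X m = (SUP f\<in>{f \<in> X. norm f \<le> 1}. cmod (m f))"

text \<open>
  As an element of the dual, a character \<open>\<phi>\<close> is \<open>Blinfun \<phi>\<close>; see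
  \<open>character_bounded_linear\<close>.
\<close>

definition top_left_inv_means ::
    "('a::complex_banach_algebra \<Rightarrow> complex) \<Rightarrow> ('a \<Rightarrow>\<^sub>L complex) set \<Rightarrow> (('a \<Rightarrow>\<^sub>L complex) \<Rightarrow> complex) set"
  where "top_left_inv_means \<phi> X = {m \<in> dual_on X.
    m (Blinfun \<phi>) = 1 \<and> (\<forall>f\<in>X. \<forall>a. m (f \<bullet>\<^sub>d a) = \<phi> a * m f)}"

text \<open>
  \<open>TLIM \<phi> X\<close> stands for \<open>TLIM\<^sub>\<phi>(X\<^sup>*)\<close>. A character has norm at most 1, and \<open>m (Blinfun \<phi>) = 1\<close>
  forces the norm of \<open>m\<close> to be at least the inverse of that of \<open>\<phi>\<close>; hence \<open>TLIM \<phi> X\<close> is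
  empty unless \<open>\<phi>\<close> has norm 1.
\<close>

definition TLIM ::
    "('a::complex_banach_algebra \<Rightarrow> complex) \<Rightarrow> ('a \<Rightarrow>\<^sub>L complex) set \<Rightarrow> (('a \<Rightarrow>\<^sub>L complex) \<Rightarrow> complex) set"
  where "TLIM \<phi> X = {m \<in> top_left_inv_means \<phi> X. dual_on_norm X m = 1}"

end

theory Submission
  imports Defs
begin

text \<open>
  For \<open>f \<in> \<A>\<^sup>*\<close> and \<open>u \<in> \<A>\<close> the functional \<open>f \<cdot> u\<close> on \<open>\<A>\<close> is continuous for the multiplier norm,
  hence extends to some \<open>F f u \<in> \<A>\<^sub>M\<^sup>*\<close>. A mean \<open>m\<close> on \<open>\<A>\<^sup>*\<close> induces the mean \<open>f \<mapsto> m (f \<circ> \<iota>)\<close>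
  on any suitable \<open>X \<subseteq> \<A>\<^sub>M\<^sup>*\<close>. In the other direction, for a mean \<open>M\<close> on \<open>X\<close> the functional
  \<open>u \<mapsto> M (F f u)\<close> vanishes on products \<open>a b\<close> with \<open>b \<in> I\<^sub>\<phi>\<close>, since \<open>F f (a b) = F f a \<cdot> \<iota> b\<close>.
  By hypothesis it then vanishes on \<open>I\<^sub>\<phi>\<close>, so it is \<open>\<phi> u\<close> times a number \<open>N f\<close>, and \<open>N\<close> is
  the mean on \<open>\<A>\<^sup>*\<close> that induces \<open>M\<close>; it has norm 1 because \<open>\<phi>\<close> has. Taking the identity for \<open>\<iota>\<close>
  and \<open>X = LUC(\<A>\<^sup>*)\<close>, or the embedding into \<open>\<A>\<^sub>M\<close> and \<open>X = \<A>\<^sub>M\<^sup>*\<close> or \<open>X = LUC(\<A>\<^sub>M\<^sup>*)\<close>, one finds that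
  all the sets of means are in bijection with the one on \<open>\<A>\<^sup>*\<close>.
\<close>

section \<open>Complex subspaces, closures and extension from a dense range\<close>

lemma subspace_closure_complex:
  fixes S :: "'v::complex_normed_vector set"
  assumes "complex_vector.subspace S"
  shows "complex_vector.subspace (closure S)"
proof (rule complex_vector.subspaceI)
  show "0 \<in> closure S"
    using complex_vector.subspace_0[OF assms] closure_subset by blast
next
  fix x y assume "x \<in> closure S" "y \<in> closure S"
  then obtain p q where "\<And>n. p n \<in> S" "p \<longlonglongrightarrow> x" "\<And>n. q n \<in> S" "q \<longlonglongrightarrow> y"
    unfolding closure_sequential by blast
  then have "\<forall>n. p n + q n \<in> S" "(\<lambda>n. p n + q n) \<longlonglongrightarrow> x + y"
    by (simp_all add: complex_vector.subspace_add[OF assms] tendsto_add)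
  then show "x + y \<in> closure S"
    unfolding closure_sequential by (intro exI[of _ "\<lambda>n. p n + q n"] conjI)
next
  fix x c assume "x \<in> closure S"
  then obtain p where "\<And>n. p n \<in> S" "p \<longlonglongrightarrow> x"
    unfolding closure_sequential by blast
  then have "\<forall>n. c *\<^sub>C p n \<in> S" "(\<lambda>n. c *\<^sub>C p n) \<longlonglongrightarrow> c *\<^sub>C x"
    using bounded_linear.tendsto[OF bounded_linear_scaleC]
    by (simp_all add: complex_vector.subspace_scale[OF assms])
  then show "c *\<^sub>C x \<in> closure S"
    unfolding closure_sequential by (intro exI[of _ "\<lambda>n. c *\<^sub>C p n"] conjI)
qed

text \<open>Reduces a claim about \<open>LUC\<close>, or by the hypothesis on \<open>\<phi>\<close>
  about \<open>char_ideal \<phi>\<close>, to the generating functionals or products.\<close>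

lemma closure_cspan_induct:
  fixes S :: "'v::complex_normed_vector set"
  assumes "x \<in> closure (cspan S)" "S \<subseteq> T" "complex_vector.subspace T" "closed T"
  shows "x \<in> T"
  using closure_minimal[OF complex_vector.span_minimal[OF assms(2,3)] assms(4)] assms(1) by (rule subsetD)

text \<open>The bound makes \<open>g\<close> vanish wherever \<open>\<iota>\<close> does, so
  \<open>g\<close> factors through \<open>\<iota>\<close>. The factor is Lipschitz on the range and
  extends continuously to its closure; linearity and the bound follow by density. The absolute value
  allows for a negative \<open>K\<close>.\<close>

lemma bounded_linear_extend_dense:
  fixes \<iota> :: "'v::real_normed_vector \<Rightarrow> 'w::real_normed_vector" and g :: "'v \<Rightarrow> 'c::banach"
  assumes \<iota>: "linear \<iota>" "closure (range \<iota>) = UNIV" and g: "linear g"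
    and le: "\<And>x. norm (g x) \<le> K * norm (\<iota> x)"
  obtains h :: "'w \<Rightarrow>\<^sub>L 'c" where "\<And>x. blinfun_apply h (\<iota> x) = g x" "norm h \<le> \<bar>K\<bar>"
proof -
  have leK: "norm (g x) \<le> \<bar>K\<bar> * norm (\<iota> x)" for x
    by (rule order_trans[OF le]) (simp add: mult_right_mono)
  define G where "G y = g (inv \<iota> y)" for y
  have G: "G (\<iota> x) = g x" for x
  proof -
    have "\<iota> (inv \<iota> (\<iota> x) - x) = 0"
      by (simp add: linear_diff[OF \<iota>(1)] f_inv_into_f)
    then have "g (inv \<iota> (\<iota> x) - x) = 0"
      using le[of "inv \<iota> (\<iota> x) - x"] by simp
    then show ?thesis
      by (simp add: G_def linear_diff[OF g])
  qed
  have "dist (G y) (G x) \<le> \<bar>K\<bar> * dist y x" if "x \<in> range \<iota>" "y \<in> range \<iota>" for x y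
    using that leK by (auto simp: G dist_norm simp flip: linear_diff[OF g] linear_diff[OF \<iota>(1)])
  then have "\<bar>K\<bar>-lipschitz_on (range \<iota>) G"
    by (intro lipschitz_onI) auto
  then have "uniformly_continuous_on (range \<iota>) G"
    by (rule lipschitz_on_uniformly_continuous)
  then obtain h where uc: "uniformly_continuous_on (closure (range \<iota>)) h"
      and h': "\<And>y. y \<in> range \<iota> \<Longrightarrow> G y = h y"
    by (rule uniformly_continuous_on_extension_on_closure) blast
  have h: "h (\<iota> x) = g x" for x
    using h'[of "\<iota> x"] G by simp
  have cont: "continuous_on UNIV h"
    using uniformly_continuous_imp_continuous[OF uc] by (simp add: \<iota>)
  have comp: "continuous_on UNIV (\<lambda>x. h (k x))" if "continuous_on UNIV k" for k :: "'w \<Rightarrow> 'w"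
    using continuous_on_compose2[OF cont that] by simp
  have eq: "p x = q x"
    if "continuous_on UNIV p" "continuous_on UNIV q" "\<And>a. p (\<iota> a) = q (\<iota> a)"
    for p q :: "'w \<Rightarrow> 'c" and x
  proof -
    have "closure (range \<iota>) \<subseteq> {x. p x = q x}"
      using that by (intro closure_minimal closed_Collect_eq) auto
    then show ?thesis
      by (auto simp: \<iota>)
  qed
  have nle: "norm (h x) \<le> \<bar>K\<bar> * norm x" for x
  proof -
    have "closure (range \<iota>) \<subseteq> {x. norm (h x) \<le> \<bar>K\<bar> * norm x}"
      using leK by (intro closure_minimal closed_Collect_le continuous_intros cont) (auto simp: h)
    then show ?thesis
      by (auto simp: \<iota>)
  qed
  have bl: "bounded_linear h"
  proof (rule bounded_linear_intro)
    show "h (x + y) = h x + h y" for x y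
    proof -
      have 1: "continuous_on UNIV (\<lambda>x. h (x + z))" "continuous_on UNIV (\<lambda>y. h (z + y))" for z
        by (rule comp, intro continuous_intros)+
      have 2: "continuous_on UNIV (\<lambda>x. h x + z)" "continuous_on UNIV (\<lambda>y. z + h y)" for z
        by (intro continuous_intros cont)+
      \<comment> \<open>Density is used in one variable at a time: first in \<open>x\<close>, with
        the other argument in the range of \<open>\<iota>\<close>, then in \<open>y\<close>.\<close>
      have "h (\<iota> a + \<iota> b) = h (\<iota> a) + h (\<iota> b)" for a b
        unfolding linear_add[OF \<iota>(1), symmetric] h by (rule linear_add[OF g])
      then have "h (x + \<iota> b) = h x + h (\<iota> b)" for x b
        by (rule eq[OF 1(1) 2(1)])
      then show ?thesis
        by (rule eq[OF 1(2) 2(2)])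
    qed
    show "h (r *\<^sub>R x) = r *\<^sub>R h x" for r x
    proof (rule eq[where p = "\<lambda>x. h (r *\<^sub>R x)"])
      show "continuous_on UNIV (\<lambda>x. h (r *\<^sub>R x))"
        by (rule comp, intro continuous_intros)
      show "continuous_on UNIV (\<lambda>x. r *\<^sub>R h x)"
        by (intro continuous_intros cont)
      show "h (r *\<^sub>R \<iota> a) = r *\<^sub>R h (\<iota> a)" for a
        unfolding linear_scale[OF \<iota>(1), symmetric] h by (rule linear_scale[OF g])
    qed
    show "norm (h x) \<le> norm x * \<bar>K\<bar>" for x
      using nle[of x] by (simp add: mult.commute)
  qed
  show thesis
  proof (rule that[of "Blinfun h"])
    show "blinfun_apply (Blinfun h) (\<iota> x) = g x" for x
      by (simp add: bounded_linear_Blinfun_apply[OF bl] h)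
    show "norm (Blinfun h) \<le> \<bar>K\<bar>"
      by (rule norm_blinfun_bound) (simp_all add: bounded_linear_Blinfun_apply[OF bl] nle)
  qed
qed

section \<open>The dual, \<open>LUC\<close> and characters as functionals\<close>

lemma subspace_dual: "complex_vector.subspace dual"
  by (rule complex_vector.subspaceI)
    (auto simp: dual_def blinfun.add_left blinfun.zero_left scaleC_blinfun.rep_eq
      scaleC_add_right scaleC_scaleC scaleC_complex_def algebra_simps)

lemma closed_dual: "closed dual"
proof -
  have eq: "dual = (\<Inter>c x. {f. blinfun_apply f (c *\<^sub>C x) = c * blinfun_apply f x})"
    by (auto simp: dual_def scaleC_complex_def)
  show ?thesis
    unfolding eq by (intro closed_INT ballI closed_Collect_eq continuous_intros)
qed

lemma dual_scaleC: "f \<in> dual \<Longrightarrow> blinfun_apply f (c *\<^sub>C x) = c * blinfun_apply f x"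
  by (simp add: dual_def scaleC_complex_def)

lemma dual_act_in_dual: "f \<in> dual \<Longrightarrow> f \<bullet>\<^sub>d a \<in> dual"
  by (simp add: dual_def dual_act.rep_eq mult_scaleC_right)

lemma subspace_LUC: "complex_vector.subspace LUC"
  unfolding LUC_def by (intro subspace_closure_complex complex_vector.subspace_span)

lemma closed_LUC: "closed LUC"
  by (simp add: LUC_def)

lemma LUC_subset_dual: "LUC \<subseteq> dual"
  unfolding LUC_def
  by (auto elim!: closure_cspan_induct intro: subspace_dual closed_dual dual_act_in_dual)

lemma dual_act_in_LUC: "f \<in> dual \<Longrightarrow> f \<bullet>\<^sub>d a \<in> LUC"
  unfolding LUC_def by (intro subsetD[OF closure_subset] complex_vector.span_base) blast

lemma norm_dual_act_le: "norm (f \<bullet>\<^sub>d a) \<le> norm f * norm a"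
proof (rule norm_blinfun_bound)
  fix x
  have "norm (blinfun_apply f (a * x)) \<le> norm f * norm (a * x)"
    by (rule norm_blinfun)
  also have "\<dots> \<le> norm f * (norm a * norm x)"
    by (intro mult_left_mono norm_mult_ineq) simp
  finally show "norm (blinfun_apply (f \<bullet>\<^sub>d a) x) \<le> norm f * norm a * norm x"
    by (simp add: dual_act.rep_eq mult.assoc)
qed simp

lemma Blinfun_character_apply: "\<phi> \<in> \<Delta> \<Longrightarrow> blinfun_apply (Blinfun \<phi>) a = \<phi> a"
  by (simp add: bounded_linear_Blinfun_apply character_bounded_linear)

lemma Blinfun_character_in_dual: "\<phi> \<in> \<Delta> \<Longrightarrow> Blinfun \<phi> \<in> dual"
  by (simp add: dual_def Blinfun_character_apply character_scaleC scaleC_complex_def)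

lemma norm_Blinfun_character_le: "\<phi> \<in> \<Delta> \<Longrightarrow> norm (Blinfun \<phi>) \<le> 1"
  by (rule norm_blinfun_bound) (simp_all add: Blinfun_character_apply character_norm_le)

section \<open>Functionals on a subspace and their norm\<close>

text \<open>Boundedness of \<open>m\<close> makes the supremum finite, and rescaling a nonzero
  \<open>f\<close> to norm 1 gives the estimate.\<close>

lemma dual_on_norm_bound:
  assumes X: "complex_vector.subspace X" and m: "m \<in> dual_on X" and f: "f \<in> X"
  shows "cmod (m f) \<le> dual_on_norm X m * norm f"
proof -
  obtain K where K: "\<And>f. f \<in> X \<Longrightarrow> cmod (m f) \<le> K * norm f"
    using m unfolding dual_on_def by blast
  have bdd: "bdd_above ((\<lambda>f. cmod (m f)) ` {f \<in> X. norm f \<le> 1})"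
  proof (rule bdd_aboveI2)
    fix g assume "g \<in> {f \<in> X. norm f \<le> 1}"
    then have "cmod (m g) \<le> K * norm g" "norm g \<le> 1"
      using K by auto
    \<comment> \<open>\<open>K\<close> comes without a sign, hence the absolute value.\<close>
    moreover have "K * norm g \<le> \<bar>K\<bar> * 1"
      using \<open>norm g \<le> 1\<close> by (intro mult_mono) auto
    ultimately show "cmod (m g) \<le> \<bar>K\<bar>"
      by linarith
  qed
  show ?thesis
  proof (cases "f = 0")
    case True
    then show ?thesis
      using K[OF f] by simp
  next
    case False
    define c where "c = complex_of_real (inverse (norm f))"
    have "c *\<^sub>C f \<in> {f \<in> X. norm f \<le> 1}"
      using complex_vector.subspace_scale[OF X f] False by (simp add: c_def norm_scaleC norm_inverse)
    then have "cmod (m (c *\<^sub>C f)) \<le> dual_on_norm X m"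
      unfolding dual_on_norm_def by (intro cSUP_upper bdd)
    also have "m (c *\<^sub>C f) = c * m f"
      using m f by (simp add: dual_on_def scaleC_complex_def)
    also have "cmod (c * m f) = cmod (m f) / norm f"
      by (simp add: c_def norm_mult norm_inverse divide_inverse mult.commute)
    finally show ?thesis
      using False by (simp add: field_simps)
  qed
qed

text \<open>The norm is at least 1 because \<open>Blinfun \<phi>\<close> has norm at most 1 and is mapped to 1.\<close>

lemma mem_TLIM_iff:
  assumes \<phi>: "\<phi> \<in> \<Delta>" and X: "complex_vector.subspace X" and mem: "Blinfun \<phi> \<in> X"
  shows "m \<in> TLIM \<phi> X \<longleftrightarrow> m \<in> top_left_inv_means \<phi> X \<and> (\<forall>f\<in>X. cmod (m f) \<le> norm f)"
proof -
  have "dual_on_norm X m = 1" if m: "m \<in> top_left_inv_means \<phi> X" and le: "\<forall>f\<in>X. cmod (m f) \<le> norm f"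
  proof (rule antisym)
    have "{f \<in> X. norm f \<le> 1} \<noteq> {}"
      using mem norm_Blinfun_character_le[OF \<phi>] by blast
    moreover have "cmod (m f) \<le> 1" if "f \<in> {f \<in> X. norm f \<le> 1}" for f
      using le that by force
    ultimately show "dual_on_norm X m \<le> 1"
      unfolding dual_on_norm_def by (rule cSUP_least)
    have "bdd_above ((\<lambda>f. cmod (m f)) ` {f \<in> X. norm f \<le> 1})"
      using le by (intro bdd_aboveI2[where M = 1]) force
    then have "cmod (m (Blinfun \<phi>)) \<le> dual_on_norm X m"
      unfolding dual_on_norm_def using mem norm_Blinfun_character_le[OF \<phi>] by (intro cSUP_upper) auto
    then show "1 \<le> dual_on_norm X m"
      using m by (simp add: top_left_inv_means_def)
  qed
  moreover have "cmod (m f) \<le> norm f"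
    if "m \<in> top_left_inv_means \<phi> X" "dual_on_norm X m = 1" "f \<in> X" for f
    using dual_on_norm_bound[OF X _ that(3), of m] that by (simp add: top_left_inv_means_def)
  ultimately show ?thesis
    by (auto simp: TLIM_def)
qed

lemma dual_onI:
  assumes "m \<in> extensional X"
    and "\<And>f g. f \<in> X \<Longrightarrow> g \<in> X \<Longrightarrow> m (f + g) = m f + m g"
    and "\<And>c f. f \<in> X \<Longrightarrow> m (c *\<^sub>C f) = c * m f"
    and "\<And>f. f \<in> X \<Longrightarrow> cmod (m f) \<le> norm f"
  shows "m \<in> dual_on X"
proof -
  have "\<forall>f\<in>X. cmod (m f) \<le> 1 * norm f"
    using assms(4) by simp
  then show ?thesis
    unfolding dual_on_def scaleC_complex_def using assms(1-3) by blast
qed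

section \<open>Dense embeddings with a multiplier estimate\<close>

text \<open>Collects what the identity of \<open>'a\<close> and the embedding into the multiplier
  completion share. The estimate \<open>norm_mult_le_\<iota>\<close> is what makes
  \<open>f \<bullet>\<^sub>d u\<close> continuous for the norm of \<open>\<iota> x\<close>.\<close>

locale multiplier_embedding =
  fixes \<iota> :: "'a::complex_banach_algebra \<Rightarrow> 'b::complex_banach_algebra"
    and \<phi> :: "'a \<Rightarrow> complex" and \<psi> :: "'b \<Rightarrow> complex"
  assumes \<iota>_add: "\<iota> (a + b) = \<iota> a + \<iota> b"
    and \<iota>_scaleC: "\<iota> (c *\<^sub>C a) = c *\<^sub>C \<iota> a"
    and \<iota>_mult: "\<iota> (a * b) = \<iota> a * \<iota> b"
    and norm_\<iota>_le: "norm (\<iota> a) \<le> norm a"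
    and norm_mult_le_\<iota>: "norm (a * b) \<le> norm a * norm (\<iota> b)"
    and dense_\<iota>: "closure (range \<iota>) = UNIV"
    and \<phi>: "\<phi> \<in> \<Delta>" "onorm \<phi> = 1"
    and \<psi>: "\<psi> \<in> \<Delta>" "\<psi> (\<iota> a) = \<phi> a"
    and char_ideal_eq: "closure (cspan {a * b | a b. b \<in> char_ideal \<phi>}) = char_ideal \<phi>"
begin

lemma bounded_linear_\<iota>: "bounded_linear \<iota>"
  using norm_\<iota>_le by (intro bounded_linear_intro[where K = 1]) (simp_all add: \<iota>_add \<iota>_scaleC scaleR_scaleC)

lemma eq_on_dense:
  fixes p q :: "'b \<Rightarrow> complex"
  assumes "continuous_on UNIV p" "continuous_on UNIV q" "\<And>a. p (\<iota> a) = q (\<iota> a)"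
  shows "p x = q x"
proof -
  have "closure (range \<iota>) \<subseteq> {x. p x = q x}"
    using assms by (intro closure_minimal closed_Collect_eq) auto
  then show ?thesis
    by (auto simp: dense_\<iota>)
qed

lemma blinfun_eq_on_dense:
  fixes f g :: "'b \<Rightarrow>\<^sub>L complex"
  assumes "\<And>a. blinfun_apply f (\<iota> a) = blinfun_apply g (\<iota> a)"
  shows "f = g"
  by (rule blinfun_eqI, rule eq_on_dense) (intro continuous_intros assms)+

text \<open>Density of the range of \<open>\<iota>\<close> leaves only one functional with these
  values. The same uniqueness proves the algebraic rules for \<open>F\<close> below.\<close>

definition F :: "('a \<Rightarrow>\<^sub>L complex) \<Rightarrow> 'a \<Rightarrow> ('b \<Rightarrow>\<^sub>L complex)"
  where "F f u = (SOME h. (\<forall>x. blinfun_apply h (\<iota> x) = blinfun_apply f (u * x))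
    \<and> norm h \<le> norm f * norm u)"

lemma F_apply: "blinfun_apply (F f u) (\<iota> x) = blinfun_apply f (u * x)"
  and norm_F_le: "norm (F f u) \<le> norm f * norm u"
proof -
  have lin: "linear (\<lambda>x. blinfun_apply f (u * x))"
    by (intro bounded_linear.linear bounded_linear_compose[OF blinfun.bounded_linear_right]
        bounded_linear_mult_right)
  have "norm (blinfun_apply f (u * x)) \<le> norm f * norm u * norm (\<iota> x)" for x
  proof -
    have "norm (blinfun_apply f (u * x)) \<le> norm f * norm (u * x)"
      by (rule norm_blinfun)
    also have "\<dots> \<le> norm f * (norm u * norm (\<iota> x))"
      by (intro mult_left_mono norm_mult_le_\<iota>) simp
    finally show ?thesis
      by (simp add: mult.assoc)
  qed
  then obtain h :: "'b \<Rightarrow>\<^sub>L complex"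
    where "\<And>x. blinfun_apply h (\<iota> x) = blinfun_apply f (u * x)" "norm h \<le> \<bar>norm f * norm u\<bar>"
    by (rule bounded_linear_extend_dense[OF bounded_linear.linear[OF bounded_linear_\<iota>] dense_\<iota> lin]) blast
  then have "\<exists>h. (\<forall>x. blinfun_apply h (\<iota> x) = blinfun_apply f (u * x)) \<and> norm h \<le> norm f * norm u"
    by auto
  from someI_ex[OF this] show "blinfun_apply (F f u) (\<iota> x) = blinfun_apply f (u * x)"
    "norm (F f u) \<le> norm f * norm u"
    by (simp_all add: F_def)
qed

lemma F_in_dual:
  assumes "f \<in> dual"
  shows "F f u \<in> dual"
proof -
  have "blinfun_apply (F f u) (c *\<^sub>C x) = c * blinfun_apply (F f u) x" for c x
  proof (rule eq_on_dense[where p = "\<lambda>x. blinfun_apply (F f u) (c *\<^sub>C x)"])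
    show "continuous_on UNIV (\<lambda>x. blinfun_apply (F f u) (c *\<^sub>C x))"
      by (intro linear_continuous_on bounded_linear_compose[OF blinfun.bounded_linear_right]
          bounded_linear_scaleC)
    show "blinfun_apply (F f u) (c *\<^sub>C \<iota> a) = c * blinfun_apply (F f u) (\<iota> a)" for a
      by (simp add: F_apply mult_scaleC_right dual_scaleC[OF assms] flip: \<iota>_scaleC)
  qed (intro continuous_intros)
  then show ?thesis
    by (simp add: dual_def scaleC_complex_def)
qed

lemma F_add_left: "F (f + g) u = F f u + F g u"
  by (rule blinfun_eq_on_dense) (simp add: F_apply blinfun.add_left)

lemma F_scaleC_left: "F (c *\<^sub>C f) u = c *\<^sub>C F f u"
  by (rule blinfun_eq_on_dense) (simp add: F_apply scaleC_blinfun.rep_eq)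

lemma F_add_right: "F f (u + v) = F f u + F f v"
  by (rule blinfun_eq_on_dense) (simp add: F_apply blinfun.add_left blinfun.add_right distrib_right)

lemma F_scaleC_right: "f \<in> dual \<Longrightarrow> F f (c *\<^sub>C u) = c *\<^sub>C F f u"
  by (rule blinfun_eq_on_dense)
    (simp add: F_apply scaleC_blinfun.rep_eq mult_scaleC_left dual_scaleC scaleC_complex_def)

lemma bounded_linear_F: "f \<in> dual \<Longrightarrow> bounded_linear (F f)"
  by (rule bounded_linear_intro[where K = "norm f"])
    (use norm_F_le in \<open>simp_all add: F_add_right F_scaleC_right scaleR_scaleC mult.commute\<close>)

text \<open>Both sides send \<open>\<iota> x\<close> to the value of \<open>f\<close> at
  \<open>a * b * x\<close>. A product in the second argument of \<open>F\<close> thus becomes a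
  module action, to which the invariance of a mean applies.\<close>

lemma F_mult: "F f (a * b) = F f a \<bullet>\<^sub>d \<iota> b"
  by (rule blinfun_eq_on_dense) (simp add: F_apply dual_act.rep_eq mult.assoc flip: \<iota>_mult)

lemma F_dual_act: "F (f \<bullet>\<^sub>d a) u = F f (a * u)"
  by (rule blinfun_eq_on_dense) (simp add: F_apply dual_act.rep_eq mult.assoc)

text \<open>Multiplicativity splits \<open>\<phi> (u * x)\<close>. At \<open>u\<close> with
  \<open>\<phi> u = 1\<close> this yields \<open>Blinfun \<psi>\<close> itself, as needed to
  normalize the means.\<close>

lemma F_character: "F (Blinfun \<phi>) u = \<phi> u *\<^sub>C Blinfun \<psi>"
  by (rule blinfun_eq_on_dense)
    (simp add: F_apply Blinfun_character_apply \<phi> \<psi> character_mult scaleC_blinfun.rep_eq scaleC_complex_def)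

section \<open>Restriction of functionals along the embedding\<close>

definition pullback :: "('b \<Rightarrow>\<^sub>L complex) \<Rightarrow> ('a \<Rightarrow>\<^sub>L complex)"
  where "pullback f = f o\<^sub>L Blinfun \<iota>"

lemma pullback_apply: "blinfun_apply (pullback f) a = blinfun_apply f (\<iota> a)"
  by (simp add: pullback_def bounded_linear_Blinfun_apply bounded_linear_\<iota>)

lemma pullback_in_dual: "f \<in> dual \<Longrightarrow> pullback f \<in> dual"
  by (simp add: dual_def pullback_apply \<iota>_scaleC)

lemma pullback_add: "pullback (f + g) = pullback f + pullback g"
  and pullback_scaleC: "pullback (c *\<^sub>C f) = c *\<^sub>C pullback f"
  by (rule blinfun_eqI;
      simp add: pullback_apply blinfun.add_left scaleC_blinfun.rep_eq)+

lemma norm_pullback_le: "norm (pullback f) \<le> norm f"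
proof (rule norm_blinfun_bound)
  fix x
  have "norm (blinfun_apply f (\<iota> x)) \<le> norm f * norm (\<iota> x)"
    by (rule norm_blinfun)
  also have "\<dots> \<le> norm f * norm x"
    by (intro mult_left_mono norm_\<iota>_le) simp
  finally show "norm (blinfun_apply (pullback f) x) \<le> norm f * norm x"
    by (simp add: pullback_apply)
qed simp

lemma pullback_F: "pullback (F f u) = f \<bullet>\<^sub>d u"
  by (rule blinfun_eqI) (simp add: pullback_apply F_apply dual_act.rep_eq)

lemma F_pullback: "F (pullback f) u = f \<bullet>\<^sub>d \<iota> u"
  by (rule blinfun_eq_on_dense) (simp add: F_apply pullback_apply dual_act.rep_eq \<iota>_mult)

lemma pullback_dual_act: "pullback (f \<bullet>\<^sub>d \<iota> a) = pullback f \<bullet>\<^sub>d a"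
  by (rule blinfun_eqI) (simp add: pullback_apply dual_act.rep_eq \<iota>_mult)

lemma pullback_character: "pullback (Blinfun \<psi>) = Blinfun \<phi>"
  by (rule blinfun_eqI) (simp add: pullback_apply Blinfun_character_apply \<phi> \<psi>)

lemma char_ideal_closure: "a \<in> char_ideal \<phi> \<Longrightarrow> a \<in> closure (cspan {a * b | a b. b \<in> char_ideal \<phi>})"
  by (simp only: char_ideal_eq)

lemma ex_unit: "\<exists>u. \<phi> u = 1"
proof -
  obtain u where "\<phi> u \<noteq> 0"
    using \<phi> by (auto simp: characters_def)
  then show ?thesis
    by (intro exI[of _ "inverse (\<phi> u) *\<^sub>C u"]) (simp add: character_scaleC[OF \<phi>(1)])
qed

text \<open>For fixed \<open>f\<close> the \<open>u\<close> with \<open>F f u\<close> in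
  \<open>LUC\<close> form a closed subspace. It contains all products by \<open>F_mult\<close>,
  hence \<open>char_ideal \<phi>\<close> by the hypothesis on \<open>\<phi>\<close>, and every
  \<open>u\<close> is a multiple of one product modulo that ideal.\<close>

lemma F_in_LUC:
  assumes f: "f \<in> dual"
  shows "F f u \<in> LUC"
proof -
  have sub: "complex_vector.subspace {u. F f u \<in> LUC}"
    by (rule complex_vector.subspaceI)
      (simp_all add: F_add_right F_scaleC_right[OF f] linear_simps(3)[OF bounded_linear_F[OF f]]
        complex_vector.subspace_0[OF subspace_LUC] complex_vector.subspace_add[OF subspace_LUC]
        complex_vector.subspace_scale[OF subspace_LUC])
  have prod: "F f (a * b) \<in> LUC" for a b
    by (simp add: F_mult dual_act_in_LUC F_in_dual f)
  obtain u0 where u0: "\<phi> u0 = 1"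
    using ex_unit by blast
  \<comment> \<open>The correction uses \<open>u0 * u0\<close> and not \<open>u0\<close>, because
    the subtracted term must itself be a multiple of a product; \<open>\<phi>\<close> still takes
    the value 1 there.\<close>
  have "u - \<phi> u *\<^sub>C (u0 * u0) \<in> char_ideal \<phi>"
    using \<phi>(1) by (simp add: char_ideal_def character_diff character_scaleC character_mult u0)
  then have "u - \<phi> u *\<^sub>C (u0 * u0) \<in> {u. F f u \<in> LUC}"
  proof (rule closure_cspan_induct[OF char_ideal_closure])
    show "{a * b |a b. b \<in> char_ideal \<phi>} \<subseteq> {u. F f u \<in> LUC}"
      using prod by blast
    have "closed (F f -` LUC)"
      by (intro continuous_closed_vimage closed_LUC linear_continuous_at bounded_linear_F f)
    then show "closed {u. F f u \<in> LUC}"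
      by (simp add: vimage_def)
  qed (rule sub)
  from complex_vector.subspace_add[OF sub this
      complex_vector.subspace_scale[OF sub, of "u0 * u0" "\<phi> u"]] prod
  show ?thesis
    by simp
qed

section \<open>The bijection between the means on \<open>dual\<close> and those on
  \<open>X\<close>\<close>

text \<open>The conditions on \<open>X\<close> are those shared by the full dual and
  \<open>LUC\<close>; \<open>X_F\<close> allows a mean on \<open>X\<close> to be evaluated at
  \<open>F f u\<close>.\<close>

context
  fixes X :: "('b \<Rightarrow>\<^sub>L complex) set"
  assumes X: "complex_vector.subspace X" "X \<subseteq> dual"
    and X_act: "\<And>f b. f \<in> X \<Longrightarrow> f \<bullet>\<^sub>d b \<in> X"
    and X_F: "\<And>f u. f \<in> dual \<Longrightarrow> F f u \<in> X"
begin

lemma character_in_X: "Blinfun \<psi> \<in> X"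
proof -
  obtain u where "\<phi> u = 1"
    using ex_unit by blast
  then show ?thesis
    using X_F[OF Blinfun_character_in_dual[OF \<phi>(1)], of u] by (simp add: F_character scaleC_one)
qed

lemma mem_TLIM_X_iff:
  "m \<in> TLIM \<psi> X \<longleftrightarrow> m \<in> top_left_inv_means \<psi> X \<and> (\<forall>f\<in>X. cmod (m f) \<le> norm f)"
  by (rule mem_TLIM_iff[OF \<psi>(1) X(1) character_in_X])

lemma mem_TLIM_dual_iff:
  "m \<in> TLIM \<phi> dual \<longleftrightarrow> m \<in> top_left_inv_means \<phi> dual \<and> (\<forall>f\<in>dual. cmod (m f) \<le> norm f)"
  by (rule mem_TLIM_iff[OF \<phi>(1) subspace_dual Blinfun_character_in_dual[OF \<phi>(1)]])

definition push :: "(('a \<Rightarrow>\<^sub>L complex) \<Rightarrow> complex) \<Rightarrow> ('b \<Rightarrow>\<^sub>L complex) \<Rightarrow> complex"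
  where "push m = restrict (\<lambda>f. m (pullback f)) X"

text \<open>For \<open>b\<close> in the range of \<open>\<iota>\<close>, invariance of
  \<open>push m\<close> is that of \<open>m\<close>, by \<open>pullback_dual_act\<close>; it reaches
  all \<open>b\<close> because both sides are continuous in \<open>b\<close>. The bound survives
  since \<open>pullback\<close> is a contraction.\<close>

lemma push_in_TLIM:
  assumes "m \<in> TLIM \<phi> dual"
  shows "push m \<in> TLIM \<psi> X"
proof -
  have m: "m \<in> dual_on dual" "m (Blinfun \<phi>) = 1"
    and inv: "\<And>f a. f \<in> dual \<Longrightarrow> m (f \<bullet>\<^sub>d a) = \<phi> a * m f"
    and le: "\<And>f. f \<in> dual \<Longrightarrow> cmod (m f) \<le> norm f"
    using assms unfolding mem_TLIM_dual_iff top_left_inv_means_def by blast+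
  have add: "m (f + g) = m f + m g" if "f \<in> dual" "g \<in> dual" for f g
    using m(1) that unfolding dual_on_def by blast
  have scl: "m (c *\<^sub>C f) = c * m f" if "f \<in> dual" for f c
    using m(1) that unfolding dual_on_def scaleC_complex_def by blast
  have pb: "pullback f \<in> dual" if "f \<in> X" for f
    by (rule pullback_in_dual) (use X(2) that in blast)
  have push: "push m f = m (pullback f)" if "f \<in> X" for f
    using that by (simp add: push_def)
  have ple: "cmod (m (pullback f)) \<le> norm f" if "f \<in> X" for f
    using le[OF pb[OF that]] norm_pullback_le[of f] by linarith
  have "push m (f \<bullet>\<^sub>d b) = \<psi> b * push m f" if f: "f \<in> X" for f b
  proof -
    \<comment> \<open>This supplies the continuity in \<open>b\<close> of the left side of the
      invariance identity.\<close>
    have bl: "bounded_linear (\<lambda>b. m (pullback (f \<bullet>\<^sub>d b)))"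
    proof (rule bounded_linear_intro)
      fix x y :: 'b and r :: real
      have "pullback (f \<bullet>\<^sub>d (x + y)) = pullback (f \<bullet>\<^sub>d x) + pullback (f \<bullet>\<^sub>d y)"
        by (rule blinfun_eqI)
          (simp add: pullback_apply dual_act.rep_eq blinfun.add_left blinfun.add_right distrib_right)
      then show "m (pullback (f \<bullet>\<^sub>d (x + y))) = m (pullback (f \<bullet>\<^sub>d x)) + m (pullback (f \<bullet>\<^sub>d y))"
        using f by (simp add: add pb X_act)
      have "pullback (f \<bullet>\<^sub>d (r *\<^sub>R x)) = r *\<^sub>R pullback (f \<bullet>\<^sub>d x)"
        by (rule blinfun_eqI)
          (simp add: pullback_apply dual_act.rep_eq blinfun.scaleR_left blinfun.scaleR_right)
      then show "m (pullback (f \<bullet>\<^sub>d (r *\<^sub>R x))) = r *\<^sub>R m (pullback (f \<bullet>\<^sub>d x))"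
        using scl[OF pb[OF X_act[OF f]], of "complex_of_real r" x]
        by (simp add: scaleR_scaleC[of r "pullback _"] scaleR_conv_of_real)
      show "norm (m (pullback (f \<bullet>\<^sub>d x))) \<le> norm x * norm f"
        using ple[OF X_act[OF f], of x] norm_dual_act_le[of f x] by (simp add: mult.commute)
    qed
    have "m (pullback (f \<bullet>\<^sub>d b)) = \<psi> b * m (pullback f)"
    proof (rule eq_on_dense[where p = "\<lambda>b. m (pullback (f \<bullet>\<^sub>d b))"])
      show "continuous_on UNIV (\<lambda>b. m (pullback (f \<bullet>\<^sub>d b)))"
        by (rule linear_continuous_on[OF bl])
      show "continuous_on UNIV (\<lambda>b. \<psi> b * m (pullback f))"
        by (rule continuous_on_mult_right)
          (rule linear_continuous_on[OF character_bounded_linear[OF \<psi>(1)]])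
      show "m (pullback (f \<bullet>\<^sub>d \<iota> a)) = \<psi> (\<iota> a) * m (pullback f)" for a
        by (simp add: pullback_dual_act inv[OF pb[OF f]] \<psi>(2))
    qed
    then show ?thesis
      using f by (simp add: push X_act)
  qed
  moreover have "push m (Blinfun \<psi>) = 1"
    by (simp add: push character_in_X pullback_character m)
  moreover have "push m \<in> dual_on X"
    by (rule dual_onI)
      (simp_all add: push ple complex_vector.subspace_add[OF X(1)] complex_vector.subspace_scale[OF X(1)]
        pullback_add pullback_scaleC add scl pb, simp add: push_def)
  ultimately show ?thesis
    by (simp add: mem_TLIM_X_iff top_left_inv_means_def push ple)
qed

text \<open>The element \<open>u\<close> is meant to satisfy \<open>\<phi> u = 1\<close>; for
  \<open>M\<close> in \<open>TLIM \<psi> X\<close> its choice is then immaterial, by the step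
  \<open>MF\<close> of the next proof.\<close>

definition pull :: "'a \<Rightarrow> (('b \<Rightarrow>\<^sub>L complex) \<Rightarrow> complex) \<Rightarrow> ('a \<Rightarrow>\<^sub>L complex) \<Rightarrow> complex"
  where "pull u M = restrict (\<lambda>f. M (F f u)) dual"

lemma pull_in_TLIM:
  assumes M: "M \<in> TLIM \<psi> X" and u0: "\<phi> u0 = 1"
  shows "pull u0 M \<in> TLIM \<phi> dual"
proof -
  have M1: "M \<in> dual_on X" "M (Blinfun \<psi>) = 1"
    and inv: "\<And>f a. f \<in> X \<Longrightarrow> M (f \<bullet>\<^sub>d a) = \<psi> a * M f"
    and le: "\<And>f. f \<in> X \<Longrightarrow> cmod (M f) \<le> norm f"
    using M unfolding mem_TLIM_X_iff top_left_inv_means_def by blast+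
  have add: "M (f + g) = M f + M g" if "f \<in> X" "g \<in> X" for f g
    using M1(1) that unfolding dual_on_def by blast
  have scl: "M (c *\<^sub>C f) = c * M f" if "f \<in> X" for f c
    using M1(1) that unfolding dual_on_def scaleC_complex_def by blast
  have bound: "cmod (M (F f u)) \<le> norm f * norm u" if "f \<in> dual" for f u
    using le[OF X_F[OF that], of u] norm_F_le[of f u] by linarith
  \<comment> \<open>As a functional of \<open>u\<close>, the left side vanishes on the kernel of
    \<open>\<phi>\<close>, so it is a multiple of \<open>\<phi>\<close>; the factor is read off at
    \<open>u0\<close>.\<close>
  have MF: "M (F f u) = \<phi> u * M (F f u0)" if f: "f \<in> dual" for f u
  proof -
    have A: "M (F f (x + y)) = M (F f x) + M (F f y)" for x y
      by (simp add: F_add_right add X_F f)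
    have C: "M (F f (c *\<^sub>C x)) = c * M (F f x)" for c x
      using scl[OF X_F[OF f]] by (simp add: F_scaleC_right f)
    have bl: "bounded_linear (\<lambda>u. M (F f u))"
      by (rule bounded_linear_intro[where K = "norm f"])
        (use bound[OF f] in \<open>simp_all add: A C scaleR_scaleC scaleC_complex_def mult.commute\<close>)
    have "u - \<phi> u *\<^sub>C u0 \<in> char_ideal \<phi>"
      using \<phi> by (simp add: char_ideal_def character_diff character_scaleC u0)
    then have "u - \<phi> u *\<^sub>C u0 \<in> {u. M (F f u) = 0}"
    proof (rule closure_cspan_induct[OF char_ideal_closure])
      \<comment> \<open>By \<open>F_mult\<close> and invariance, \<open>M\<close> at
        \<open>F f (a * b)\<close> carries the factor
        \<open>\<psi> (\<iota> b) = \<phi> b = 0\<close>.\<close>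
      show "{a * b |a b. b \<in> char_ideal \<phi>} \<subseteq> {u. M (F f u) = 0}"
        by (auto simp: F_mult inv X_F f \<psi> char_ideal_def)
      show "complex_vector.subspace {u. M (F f u) = 0}"
        by (rule complex_vector.subspaceI) (simp_all add: A C linear_simps(3)[OF bl])
      show "closed {u. M (F f u) = 0}"
        by (rule closed_Collect_eq[OF linear_continuous_on[OF bl] continuous_on_const])
    qed
    then have "M (F f (u - \<phi> u *\<^sub>C u0)) = 0"
      by simp
    moreover have "M (F f u) = M (F f (u - \<phi> u *\<^sub>C u0)) + M (F f (\<phi> u *\<^sub>C u0))"
      by (simp flip: A)
    ultimately show ?thesis
      by (simp add: C)
  qed
  have pull: "pull u0 M f = M (F f u0)" if "f \<in> dual" for f
    using that by (simp add: pull_def)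
  \<comment> \<open>The estimate at \<open>u0\<close> alone would leave the factor
    \<open>norm u0\<close>. Applying \<open>MF\<close> to all \<open>u\<close> instead bounds
    \<open>onorm \<phi>\<close> by \<open>norm f / cmod (M (F f u0))\<close>, and
    \<open>onorm \<phi> = 1\<close> gives a constant of exactly 1.\<close>
  have nle: "cmod (pull u0 M f) \<le> norm f" if f: "f \<in> dual" for f
  proof (rule ccontr)
    assume *: "\<not> cmod (pull u0 M f) \<le> norm f"
    then have pos: "cmod (M (F f u0)) > 0"
      using f norm_ge_zero[of f] unfolding pull[OF f] by linarith
    have "norm (\<phi> u) \<le> norm f / cmod (M (F f u0)) * norm u" for u
      using bound[OF f, of u] pos by (simp add: MF[OF f, of u] norm_mult field_simps)
    then have "onorm \<phi> \<le> norm f / cmod (M (F f u0))"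
      by (intro onorm_bound) auto
    then show False
      using * pos f \<phi>(2) by (simp add: pull field_simps)
  qed
  \<comment> \<open>By \<open>F_dual_act\<close> the left side is \<open>M (F f (a * u0))\<close>,
    and \<open>MF\<close> applies with \<open>\<phi> (a * u0) = \<phi> a\<close>.\<close>
  have "pull u0 M (f \<bullet>\<^sub>d a) = \<phi> a * pull u0 M f" if "f \<in> dual" for f a
    using that MF[OF that, of "a * u0"] \<phi>(1) u0
    by (simp add: pull dual_act_in_dual F_dual_act character_mult)
  moreover have "pull u0 M (Blinfun \<phi>) = 1"
    by (simp add: pull Blinfun_character_in_dual \<phi> F_character u0 scaleC_one M1)
  moreover have "pull u0 M \<in> dual_on dual"
    by (rule dual_onI)
      (simp_all add: nle, simp_all add: pull complex_vector.subspace_add[OF subspace_dual]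
        complex_vector.subspace_scale[OF subspace_dual] F_add_left F_scaleC_left
        add scl X_F, simp add: pull_def)
  ultimately show "pull u0 M \<in> TLIM \<phi> dual"
    by (simp add: mem_TLIM_dual_iff top_left_inv_means_def nle)
qed

text \<open>By \<open>pullback_F\<close> and \<open>F_pullback\<close> the two composites send
  \<open>m\<close> and \<open>M\<close> to their values at \<open>f \<bullet>\<^sub>d u0\<close> and
  \<open>f \<bullet>\<^sub>d \<iota> u0\<close>. Invariance and \<open>\<phi> u0 = 1\<close> return
  \<open>m f\<close> and \<open>M f\<close>; extensionality turns agreement on the subspace into
  equality.\<close>

lemma TLIM_eqpoll: "TLIM \<phi> dual \<approx> TLIM \<psi> X"
proof -
  obtain u0 where u0: "\<phi> u0 = 1"
    using ex_unit by blast
  have "bij_betw push (TLIM \<phi> dual) (TLIM \<psi> X)"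
  proof (rule bij_betw_byWitness[where f' = "pull u0"])
    show "\<forall>m\<in>TLIM \<phi> dual. pull u0 (push m) = m"
    proof
      fix m assume m: "m \<in> TLIM \<phi> dual"
      show "pull u0 (push m) = m"
      proof (rule extensionalityI[of _ dual])
        show "m \<in> extensional dual"
          using m by (simp add: TLIM_def top_left_inv_means_def dual_on_def)
        show "pull u0 (push m) f = m f" if "f \<in> dual" for f
          using m that u0
          by (simp add: pull_def push_def X_F pullback_F TLIM_def top_left_inv_means_def)
      qed (simp add: pull_def)
    qed
    show "\<forall>M\<in>TLIM \<psi> X. push (pull u0 M) = M"
    proof
      fix M assume M: "M \<in> TLIM \<psi> X"
      show "push (pull u0 M) = M"
      proof (rule extensionalityI[of _ X])
        show "M \<in> extensional X"
          using M by (simp add: TLIM_def top_left_inv_means_def dual_on_def)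
        show "push (pull u0 M) f = M f" if "f \<in> X" for f
          using M that u0 pullback_in_dual[OF subsetD[OF X(2) that]]
          by (simp add: pull_def push_def F_pullback TLIM_def top_left_inv_means_def \<psi>)
      qed (simp add: push_def)
    qed
  qed (use push_in_TLIM pull_in_TLIM u0 in auto)
  then show ?thesis
    by (auto simp: eqpoll_def)
qed

end

lemma TLIM_dual_eqpoll_dual: "TLIM \<phi> dual \<approx> TLIM \<psi> dual"
  by (rule TLIM_eqpoll) (auto intro: subspace_dual dual_act_in_dual F_in_dual)

lemma TLIM_dual_eqpoll_LUC: "TLIM \<phi> dual \<approx> TLIM \<psi> LUC"
  by (rule TLIM_eqpoll)
    (use LUC_subset_dual in \<open>auto intro: subspace_LUC dual_act_in_LUC F_in_LUC\<close>)

end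

section \<open>Estimates for the multiplier norm and the conclusion\<close>

text \<open>Scaled to norm 1, \<open>a\<close> is one of the left factors in the supremum defining
  \<open>mult_norm b\<close>. For the completion this is the assumption
  \<open>norm_mult_le_\<iota>\<close>.\<close>

lemma norm_mult_le_norm_mult_norm:
  fixes a b :: "'a::complex_banach_algebra"
  shows "norm (a * b) \<le> norm a * mult_norm b"
proof (cases "a = 0")
  case False
  define c where "c = complex_of_real (inverse (norm a)) *\<^sub>C a"
  have "norm (c * b) \<le> mult_norm b"
    unfolding mult_norm_def
  proof (rule cSup_upper)
    have "norm (b * x) \<le> norm b" "norm (x * b) \<le> norm b" if "norm x \<le> 1" for x
      using norm_mult_ineq[of b x] norm_mult_ineq[of x b] that
        mult_left_mono[OF that norm_ge_zero[of b]] by (simp_all add: mult.commute)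
    then show "bdd_above ({norm (b * x) | x. norm x \<le> 1} \<union> {norm (x * b) | x. norm x \<le> 1})"
      by (intro bdd_aboveI[of _ "norm b"]) auto
    have "norm c \<le> 1"
      using False by (simp add: c_def norm_scaleC norm_inverse)
    then show "norm (c * b) \<in> {norm (b * x) | x. norm x \<le> 1} \<union> {norm (x * b) | x. norm x \<le> 1}"
      by blast
  qed
  then show ?thesis
    using False by (simp add: c_def mult_scaleC_left norm_scaleC norm_divide field_simps)
qed simp

lemma mult_norm_le_norm: "mult_norm a \<le> norm a"
  unfolding mult_norm_def
proof (rule cSup_least)
  have "norm (a * b) \<le> norm a" "norm (b * a) \<le> norm a" if "norm b \<le> 1" for b
    using norm_mult_ineq[of a b] norm_mult_ineq[of b a] that
      mult_left_mono[OF that norm_ge_zero[of a]] by (simp_all add: mult.commute)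
  then show "x \<le> norm a" if "x \<in> {norm (a * b) | b. norm b \<le> 1} \<union> {norm (b * a) | b. norm b \<le> 1}" for x
    using that by auto
qed (auto intro: exI[of _ 0])

theorem corollary3p8:
  fixes \<iota> :: "'a::complex_banach_algebra \<Rightarrow> 'b::complex_banach_algebra"
    and \<phi> :: "'a \<Rightarrow> complex"
  assumes "faithful TYPE('a)"
    and "is_mult_completion \<iota>"
    and "\<phi> \<in> \<Delta>"
    and "onorm \<phi> = 1"
    and "closure (cspan {a * b | a b. b \<in> char_ideal \<phi>}) = char_ideal \<phi>"
  shows "TLIM (char_extension \<iota> \<phi>) LUC \<approx> TLIM \<phi> LUC
       \<and> TLIM \<phi> LUC \<approx> TLIM \<phi> dual
       \<and> TLIM \<phi> dual \<approx> TLIM (char_extension \<iota> \<phi>) dual"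
proof -
  \<comment> \<open>\<open>char_extension\<close> is a definite description, so its properties rest
    on the unique existence of the extended character.\<close>
  have ext: "char_extension \<iota> \<phi> \<in> \<Delta>" "char_extension \<iota> \<phi> (\<iota> a) = \<phi> a" for a
    using theI'[OF character_extends[OF assms(2,3)]] unfolding char_extension_def by blast+
  interpret id: multiplier_embedding "\<lambda>x. x" \<phi> \<phi>
    by (unfold_locales; (rule assms(3-5))?; simp add: norm_mult_ineq)
  interpret M: multiplier_embedding \<iota> \<phi> "char_extension \<iota> \<phi>"
    by (unfold_locales; (rule assms(3-5) ext)?; use assms(2) in
        \<open>simp add: is_mult_completion_def linear_iff_module_hom module_hom_iff
          mult_norm_le_norm norm_mult_le_norm_mult_norm\<close>)
  \<comment> \<open>The first equipollence passes through \<open>TLIM \<phi> dual\<close>.\<close>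
  show ?thesis
    by (intro conjI eqpoll_trans[OF eqpoll_sym[OF M.TLIM_dual_eqpoll_LUC] id.TLIM_dual_eqpoll_LUC]
        eqpoll_sym[OF id.TLIM_dual_eqpoll_LUC] M.TLIM_dual_eqpoll_dual)
qed

end
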